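(* Let $d_{\mathfrak a},d_{\mathfrak b}$ be positive integers with $d_{\mathfrak a}\le d_{\mathfrak b}$, and let $t$ be a non-negative integer. Then the matrix $M_{d_{\mathfrak a}}(d_{\mathfrak b},t)$ is diagonalizable.
   Context: Binomial coefficients: for $x\in\mathbb{C}$ and $k\in\mathbb{Z}$, $\binom{x}{k}=\frac{x(x-1)\cdots(x-k+1)}{k!}$ if $k\ge 0$ and $\binom{x}{k}=0$ if $k<0$. For positive integers $d_{\mathfrak a},d_{\mathfrak b}$ and a non-negative integer $t$, $M_{d_{\mathfrak a}}(d_{\mathfrak b},t)$ is the $d_{\mathfrak a}\times d_{\mathfrak a}$ matrix (regarded over $\mathbb{C}$) $$M_{d_{\mathfrak a}}(d_{\mathfrak b},t):=\left(\binom{d_{\mathfrak a}+i+t-j-1}{i+t}\binom{d_{\mathfrak b}-i-t+j-1}{j}\right)_{0\le i,j\le d_{\mathfrak a}-1}.$$ *)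

theory Defs
  imports Complex_Main "Jordan_Normal_Form.Matrix"
begin

(* The upper arguments are formed in the complex numbers, so their subtractions do not truncate
   (the second one can be negative). The lower arguments i + t and j are non-negative, so the
   convention that a binomial coefficient with negative lower argument is 0 is never used. *)
definition M_mat :: "nat \<Rightarrow> nat \<Rightarrow> nat \<Rightarrow> complex mat" where
  "M_mat da db t = mat da da (\<lambda>(i, j).
     ((of_nat da + of_nat i + of_nat t - of_nat j - 1) gchoose (i + t)) *
     ((of_nat db - of_nat i - of_nat t + of_nat j - 1) gchoose j))"

definition diagonalizable :: "'a::field mat \<Rightarrow> bool" where
  "diagonalizable A \<longleftrightarrow> (\<exists>D. diagonal_mat D \<and> similar_mat A D)"

end

theory Submission
  imports Defs "Jordan_Normal_Form.Jordan_Normal_Form_Existence"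
    "HOL-Computational_Algebra.Formal_Power_Series"
begin

text \<open>
  The columns of the matrix are values at \<open>s = i + t\<close> of polynomials in \<open>s\<close>, so it is
  conjugate to an operator on polynomials of degree less than \<open>d\<^sub>a\<close>. That operator respects the
  degree filtration: on binomial coefficients it is computed by the Vandermonde convolution.
  Concretely, conjugation by the Pascal matrix makes \<open>M\<close> upper triangular, with the signed
  binomial coefficients \<open>(-1)\<^sup>k ((d\<^sub>a + d\<^sub>b - 1) choose (d\<^sub>a - 1 - k))\<close> on the diagonal.
  Since \<open>d\<^sub>a \<le> d\<^sub>b\<close>, these lie in the increasing half of a row of Pascal's triangle and
  are distinct.
\<close>

lemma diagonal_jordan_matrix:
  fixes n_as :: "(nat \<times> 'a :: {zero,one}) list"
  assumes "\<forall>(n, a) \<in> set n_as. n \<le> 1"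
  shows "diagonal_mat (jordan_matrix n_as)"
  using assms
proof (induction n_as)
  case Nil
  then show ?case by (simp add: diagonal_mat_def)
next
  case (Cons na n_as)
  obtain n a where na: "na = (n, a)" by force
  with Cons.prems have n: "n \<le> 1" by simp
  have IH: "diagonal_mat (jordan_matrix n_as)" using Cons by simp
  show ?case
    unfolding na jordan_matrix_Cons diagonal_mat_def
    using IH n by (auto simp: diagonal_mat_def)
qed

lemma order_prod_list_linear:
  fixes as :: "'a :: field list"
  shows "order x (\<Prod>a\<leftarrow>as. [:- a, 1:]) = count_list as x"
proof (induction as)
  case (Cons a as)
  have "(\<Prod>a\<leftarrow>as. [:- a, 1:]) \<noteq> 0" by (auto simp: prod_list_zero_iff)
  then have "[:- a, 1:] * (\<Prod>a\<leftarrow>as. [:- a, 1:]) \<noteq> 0"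
    by (intro no_zero_divisors) auto
  from order_mult[OF this] show ?case
    by (simp add: Cons.IH order_linear')
qed (simp add: order_1_eq_0)

text \<open>A Jordan block for an eigenvalue is no larger than the multiplicity of that eigenvalue
  in the characteristic polynomial. Distinct diagonal entries make every multiplicity at most 1, so
  the Jordan form is already diagonal.\<close>

lemma diagonalizable_upper_triangular_distinct:
  fixes A :: "'a :: conjugatable_ordered_field mat"
  assumes A: "A \<in> carrier_mat n n" "upper_triangular A" and dist: "distinct (diag_mat A)"
  shows "diagonalizable A"
proof -
  have cp: "char_poly A = (\<Prod>a\<leftarrow>diag_mat A. [:- a, 1:])"
    by (rule char_poly_upper_triangular[OF A])
  from jordan_nf_exists[OF A(1) cp] obtain n_as where jnf: "jordan_nf A n_as" ..
  have "m \<le> 1" if "(m, a) \<in> set n_as" for m a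
  proof (cases "m = 0")
    case False
    have "m \<le> order a (char_poly A)"
      by (rule jordan_nf_block_size_order_bound[OF jnf that])
    also have "\<dots> \<le> 1"
      unfolding cp order_prod_list_linear using dist
      by (simp add: distinct_count_atmost_1 flip: count_mset)
    finally show ?thesis .
  qed simp
  then have "diagonal_mat (jordan_matrix n_as)"
    by (intro diagonal_jordan_matrix) auto
  with jnf show ?thesis unfolding diagonalizable_def jordan_nf_def by blast
qed

text \<open>Stated through \<open>A * P = P * B\<close> so that no explicit inverse of
  \<open>P\<close> has to be computed; the determinant supplies one.\<close>

lemma similar_mat_intertwining:
  fixes A :: "'a :: field mat"
  assumes carr: "A \<in> carrier_mat n n" "B \<in> carrier_mat n n" "P \<in> carrier_mat n n"
    and det: "det P \<noteq> 0" and eq: "A * P = P * B"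
  shows "similar_mat A B"
proof -
  from det_non_zero_imp_unit[OF carr(3) det, of n]
  obtain Q where Q: "Q \<in> carrier_mat n n" "Q * P = 1\<^sub>m n" "P * Q = 1\<^sub>m n"
    unfolding Units_def ring_mat_def by auto
  have "P * B * Q = A * (P * Q)"
    unfolding eq[symmetric] by (rule assoc_mult_mat[OF carr(1,3) Q(1)])
  also have "\<dots> = A" using carr(1) by (simp add: Q(3))
  finally show ?thesis
    using carr Q by (intro similar_matI[of A B P Q n]) auto
qed

lemma diagonalizable_similar:
  assumes "similar_mat A B" and "diagonalizable B"
  shows "diagonalizable A"
  using assms similar_mat_trans unfolding diagonalizable_def by blast

text \<open>Column \<open>k\<close> lists the values of the polynomial (x choose k) at x = 0, ..., n
  - 1, so this is the change from the binomial basis to values at these points.\<close>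

definition pascal_mat :: "nat \<Rightarrow> complex mat" where
  "pascal_mat n = mat n n (\<lambda>(i, k). of_nat i gchoose k)"

definition M_eigenvalue :: "nat \<Rightarrow> nat \<Rightarrow> nat \<Rightarrow> complex" where
  "M_eigenvalue a b k = (- 1) ^ k * of_nat ((a + b - 1) choose (a - 1 - k))"

text \<open>Column \<open>k\<close> holds the coordinates of \<open>M_eigenvalue a b k\<close> times
  (x + t - b choose k) in the binomial basis. On the diagonal the generalized binomial is 1.\<close>

definition M_triangular :: "nat \<Rightarrow> nat \<Rightarrow> nat \<Rightarrow> complex mat" where
  "M_triangular a b t = mat a a (\<lambda>(l, k).
     if l \<le> k then M_eigenvalue a b k * (of_nat t - of_nat b gchoose (k - l)) else 0)"

lemma det_pascal_mat: "det (pascal_mat n) = 1"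
proof -
  have "det (pascal_mat n) = prod_list (diag_mat (pascal_mat n))"
    by (rule det_lower_triangular[of n])
      (auto simp: pascal_mat_def binomial_gbinomial[symmetric])
  also have "\<dots> = 1"
    by (intro prod_list_neutral)
      (auto simp: diag_mat_def pascal_mat_def binomial_gbinomial[symmetric])
  finally show ?thesis .
qed

lemma gbinomial_upper_add_minus_1:
  fixes x :: "'a :: field_char_0"
  shows "(x + of_nat k - 1) gchoose k = (- 1) ^ k * (- x gchoose k)"
  by (simp add: gbinomial_minus[of x k] flip: mult.assoc power_mult_distrib)

lemma gbinomial_symmetric_add:
  "(of_nat (m + s) :: 'a :: field_char_0) gchoose s = of_nat (m + s) gchoose m"
  using binomial_symmetric[of s "m + s"] by (simp flip: binomial_gbinomial del: of_nat_add)

text \<open>The entries of \<open>M\<close> in terms of lower arguments that sum to \<open>a - 1\<close>, so that Vandermonde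
  applies.\<close>

lemma M_entry:
  fixes s j a b :: nat
  assumes "j < a"
  shows "((of_nat a + of_nat s - of_nat j - 1) gchoose s) *
      ((of_nat b - of_nat s + of_nat j - 1) gchoose j) =
    ((- 1) ^ (a - 1) * (- of_nat s - 1 gchoose (a - 1 - j)) * (of_nat s - of_nat b gchoose j)
      :: 'a :: field_char_0)"
proof -
  define m where "m = a - 1 - j"
  have a: "a = m + j + 1" using assms by (simp add: m_def)
  \<comment> \<open>The upper argument is a natural number, so symmetry can trade the lower argument
    \<open>s\<close> for \<open>m\<close>, which does not depend on \<open>s\<close>. This makes the
    factor a polynomial in \<open>s\<close>.\<close>
  have "(of_nat a + of_nat s - of_nat j - 1 :: 'a) = of_nat (m + s)"
    by (simp add: a)
  then have "(of_nat a + of_nat s - of_nat j - 1 :: 'a) gchoose s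
      = (of_nat s + 1 + of_nat m - 1) gchoose m"
    by (simp only: gbinomial_symmetric_add) (simp add: add_ac)
  then have 1: "(of_nat a + of_nat s - of_nat j - 1 :: 'a) gchoose s
      = (- 1) ^ m * (- of_nat s - 1 gchoose m)"
    unfolding gbinomial_upper_add_minus_1 by simp
  have 2: "(of_nat b - of_nat s + of_nat j - 1 :: 'a) gchoose j
      = (- 1) ^ j * (of_nat s - of_nat b gchoose j)"
    using gbinomial_upper_add_minus_1[of "of_nat b - of_nat s :: 'a" j] by simp
  have "(- 1 :: 'a) ^ (a - 1) = (- 1) ^ m * (- 1) ^ j"
    by (simp add: a power_add)
  then show ?thesis unfolding 1 2 by (simp add: m_def)
qed

text \<open>Trinomial revision turns (x choose j)(j choose k) into (x choose k)(x - k choose j - k).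
  The first factor leaves the sum, and the rest is a Vandermonde convolution shifted by
  \<open>k\<close>.\<close>

lemma sum_gbinomial_Vandermonde_falling:
  fixes x y :: "'a :: field_char_0"
  assumes "k \<le> n"
  shows "(\<Sum>j\<le>n. (y gchoose (n - j)) * (x gchoose j) * (of_nat j gchoose k)) =
    (x gchoose k) * (x + y - of_nat k gchoose (n - k))"
proof -
  have "(\<Sum>j\<le>n. (y gchoose (n - j)) * (x gchoose j) * (of_nat j gchoose k)) =
      (\<Sum>j\<in>{k..n}. (y gchoose (n - j)) * (x gchoose j) * (of_nat j gchoose k))"
    by (rule sum.mono_neutral_right) (auto simp flip: binomial_gbinomial)
  also have "\<dots> = (\<Sum>j\<in>{k..n}. (x gchoose k) *
      ((x - of_nat k gchoose (j - k)) * (y gchoose (n - j))))"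
    by (rule sum.cong) (auto simp: mult.assoc gbinomial_trinomial_revision)
  also have "\<dots> = (\<Sum>i\<in>{0..n - k}. (x gchoose k) *
      ((x - of_nat k gchoose i) * (y gchoose (n - k - i))))"
    using assms
    by (intro sum.reindex_bij_witness[of _ "\<lambda>i. i + k" "\<lambda>j. j - k"]) auto
  also have "\<dots> = (x gchoose k) * (x - of_nat k + y gchoose (n - k))"
    by (simp only: gbinomial_Vandermonde flip: sum_distrib_left)
  finally show ?thesis by (simp add: algebra_simps)
qed

text \<open>With m = a - 1 - k, negating the upper argument gives (b + 1 + k) + m - 1 = a + b - 1,
  and the signs combine to (-1)^k because a - 1 = k + m.\<close>

lemma M_eigenvalue_alt:
  assumes "k < a"
  shows "(- 1) ^ (a - 1) * (- (of_nat b + 1 + of_nat k) gchoose (a - 1 - k)) = M_eigenvalue a b k"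
proof -
  define m where "m = a - 1 - k"
  have a: "a = m + k + 1" using assms by (simp add: m_def)
  have "- (of_nat b + 1 + of_nat k) gchoose m =
      (- 1) ^ m * (of_nat (a + b - 1) gchoose m :: complex)"
    unfolding gbinomial_minus by (simp add: a add_ac)
  moreover have "a - 1 = k + m" by (simp add: a)
  ultimately show ?thesis
    by (simp add: M_eigenvalue_def binomial_gbinomial power_add flip: m_def power_mult_distrib)
qed

lemma M_pascal_mat:
  "M_mat a b t * pascal_mat a = pascal_mat a * M_triangular a b t"
proof (rule eq_matI)
  fix i k
  assume "i < dim_row (pascal_mat a * M_triangular a b t)"
    and "k < dim_col (pascal_mat a * M_triangular a b t)"
  then have ik: "i < a" "k < a" by (simp_all add: pascal_mat_def M_triangular_def)
  define s where "s = i + t"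
  have "(M_mat a b t * pascal_mat a) $$ (i, k) =
      (\<Sum>j<a. ((of_nat a + of_nat s - of_nat j - 1) gchoose s) *
        ((of_nat b - of_nat s + of_nat j - 1) gchoose j) * (of_nat j gchoose k))"
    using ik
    by (simp add: M_mat_def pascal_mat_def scalar_prod_def s_def algebra_simps lessThan_atLeast0)
  also have "\<dots> = (\<Sum>j<a. (- 1) ^ (a - 1) * ((- of_nat s - 1 gchoose (a - 1 - j)) *
      (of_nat s - of_nat b gchoose j) * (of_nat j gchoose k)))"
    by (rule sum.cong) (simp_all add: M_entry mult.assoc)
  also have "{..<a} = {..a - 1}" using ik by auto
  also have "(\<Sum>j\<le>a - 1. (- 1) ^ (a - 1) * ((- of_nat s - 1 gchoose (a - 1 - j)) *
        (of_nat s - of_nat b gchoose j) * (of_nat j gchoose k))) =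
      (of_nat s - of_nat b gchoose k) *
      ((- 1) ^ (a - 1) * (- (of_nat b + 1 + of_nat k :: complex) gchoose (a - 1 - k)))"
  proof -
    \<comment> \<open>The row variable \<open>s\<close> cancels here, so after Vandermonde it
      survives only in (s - b choose k), a polynomial of degree \<open>k\<close>. This is where
      triangularity comes from.\<close>
    have "of_nat s - of_nat b + (- of_nat s - 1) - of_nat k = (- (of_nat b + 1 + of_nat k) :: complex)"
      by simp
    moreover have "k \<le> a - 1" using ik by simp
    ultimately show ?thesis
      by (simp only: sum_gbinomial_Vandermonde_falling mult.left_commute flip: sum_distrib_left)
  qed
  also have "\<dots> = M_eigenvalue a b k * (of_nat i + (of_nat t - of_nat b) gchoose k)"
    unfolding M_eigenvalue_alt[OF ik(2)] by (simp add: s_def algebra_simps)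
  \<comment> \<open>A second Vandermonde convolution, splitting s - b as i + (t - b), expands the
    result in the binomial basis.\<close>
  also have "\<dots> = (\<Sum>l\<in>{0..k}. (of_nat i gchoose l) *
      (M_eigenvalue a b k * (of_nat t - of_nat b gchoose (k - l))))"
    by (simp add: sum_distrib_left mult_ac flip: gbinomial_Vandermonde)
  also have "\<dots> = (\<Sum>l<a. (of_nat i gchoose l) * (if l \<le> k then
      M_eigenvalue a b k * (of_nat t - of_nat b gchoose (k - l)) else 0))"
    using ik by (intro sum.mono_neutral_cong_left) auto
  also have "\<dots> = (pascal_mat a * M_triangular a b t) $$ (i, k)"
    using ik by (simp add: M_triangular_def pascal_mat_def scalar_prod_def lessThan_atLeast0)
  finally show "(M_mat a b t * pascal_mat a) $$ (i, k) =
    (pascal_mat a * M_triangular a b t) $$ (i, k)" .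
qed (simp_all add: M_mat_def pascal_mat_def M_triangular_def)

text \<open>Norms discard the alternating signs. From \<open>a \<le> b\<close> follows 2(a - 1 - k)
  \<le> a + b - 1, so the lower arguments stay where the binomials strictly increase.\<close>

lemma inj_on_M_eigenvalue:
  assumes "a \<le> b"
  shows "inj_on (M_eigenvalue a b) {..<a}"
proof (rule linorder_inj_onI)
  fix k l assume "k < l" and "k \<in> {..<a}" and "l \<in> {..<a}"
  then have "(a + b - 1) choose (a - 1 - l) < (a + b - 1) choose (a - 1 - k)"
    using assms by (intro binomial_strict_mono) auto
  then have "norm (M_eigenvalue a b l) < norm (M_eigenvalue a b k)"
    by (simp add: M_eigenvalue_def norm_mult norm_power)
  then show "M_eigenvalue a b k \<noteq> M_eigenvalue a b l" by auto
qed auto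

theorem corollary2:
  fixes da db t :: nat
  assumes "0 < da" and "0 < db" and "da \<le> db"
  shows "diagonalizable (M_mat da db t)"
proof (rule diagonalizable_similar)
  show "similar_mat (M_mat da db t) (M_triangular da db t)"
  proof (rule similar_mat_intertwining[OF _ _ _ _ M_pascal_mat])
    show "M_mat da db t \<in> carrier_mat da da" "M_triangular da db t \<in> carrier_mat da da"
      "pascal_mat da \<in> carrier_mat da da"
      by (simp_all add: M_mat_def M_triangular_def pascal_mat_def)
  qed (simp add: det_pascal_mat)
  have "diag_mat (M_triangular da db t) = map (M_eigenvalue da db) [0..<da]"
    by (simp add: diag_mat_def M_triangular_def)
  then have "distinct (diag_mat (M_triangular da db t))"
    using inj_on_M_eigenvalue[OF assms(3)] by (simp add: distinct_map atLeast0LessThan)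
  then show "diagonalizable (M_triangular da db t)"
    by (intro diagonalizable_upper_triangular_distinct[of _ da])
      (auto simp: M_triangular_def)
qed

end
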